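(* There exists an infinite sequence of planar multigraphs $M$, each admitting an embedding into the plane without $2$-faces, such that $a(M)=\frac{3}{7}n+\frac{4}{7}$, where $n$ is the number of vertices of $M$ (and $n$ is unbounded along the sequence).
   Context: Multigraphs are finite, may have parallel edges, but have no loops. For a multigraph $M$, $a(M)$ denotes the maximum number of vertices of an induced forest in $M$ (a $2$-cycle formed by two parallel edges counts as a cycle). In a plane embedding, each edge is considered to have two sides; the degree of a face $f$ is the number of incidences between $f$ and sides of edges (an edge with the same face on both sides contributes $2$). A $2$-face is a face of degree $2$. *)

theory Defs
  imports "HOL-Analysis.Analysis"
begin

record ('v, 'e) mgraph =
  verts :: "'v set"
  edges :: "'e set"
  ends :: "'e \<Rightarrow> 'v set"

text \<open>Every edge has exactly two ends, so there are no loops; distinct edges may have the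
  same ends.\<close>

definition multigraph :: "('v, 'e) mgraph \<Rightarrow> bool" where
  "multigraph M \<longleftrightarrow> finite (verts M) \<and> finite (edges M) \<and>
     (\<forall>e\<in>edges M. ends M e \<subseteq> verts M \<and> card (ends M e) = 2)"

definition induced :: "('v, 'e) mgraph \<Rightarrow> 'v set \<Rightarrow> ('v, 'e) mgraph" where
  "induced M S = \<lparr>verts = S, edges = {e \<in> edges M. ends M e \<subseteq> S}, ends = ends M\<rparr>"

text \<open>Cycles of length 2 are included: they consist of two distinct parallel edges.\<close>

definition is_cycle :: "('v, 'e) mgraph \<Rightarrow> 'v list \<Rightarrow> 'e list \<Rightarrow> bool" where
  "is_cycle M vs es \<longleftrightarrow>
     2 \<le> length vs \<and> length es = length vs \<and> distinct vs \<and> distinct es \<and>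
     set vs \<subseteq> verts M \<and> set es \<subseteq> edges M \<and>
     (\<forall>i<length vs. ends M (es ! i) = {vs ! i, vs ! (Suc i mod length vs)})"

definition forest :: "('v, 'e) mgraph \<Rightarrow> bool" where
  "forest M \<longleftrightarrow> (\<nexists>vs es. is_cycle M vs es)"

definition max_induced_forest :: "('v, 'e) mgraph \<Rightarrow> nat" where
  "max_induced_forest M = Max {card S | S. S \<subseteq> verts M \<and> forest (induced M S)}"

definition open_edge :: "('e \<Rightarrow> real \<Rightarrow> complex) \<Rightarrow> 'e \<Rightarrow> complex set" where
  "open_edge \<gamma> e = \<gamma> e ` {0<..<1}"

text \<open>The vertex \<open>v\<close> is drawn as the point \<open>p v\<close>, the edge \<open>e\<close> as the arc \<open>\<gamma> e\<close>;
  the orientation of the arc is irrelevant.\<close>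

definition plane_embedding ::
    "('v, 'e) mgraph \<Rightarrow> ('v \<Rightarrow> complex) \<Rightarrow> ('e \<Rightarrow> real \<Rightarrow> complex) \<Rightarrow> bool" where
  "plane_embedding M p \<gamma> \<longleftrightarrow>
     inj_on p (verts M) \<and>
     (\<forall>e\<in>edges M. arc (\<gamma> e) \<and> {pathstart (\<gamma> e), pathfinish (\<gamma> e)} = p ` ends M e \<and>
        open_edge \<gamma> e \<inter> p ` verts M = {}) \<and>
     (\<forall>e\<in>edges M. \<forall>e'\<in>edges M. e \<noteq> e' \<longrightarrow> open_edge \<gamma> e \<inter> open_edge \<gamma> e' = {})"

definition planar :: "('v, 'e) mgraph \<Rightarrow> bool" where
  "planar M \<longleftrightarrow> (\<exists>p \<gamma>. plane_embedding M p \<gamma>)"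

definition faces ::
    "('v, 'e) mgraph \<Rightarrow> ('v \<Rightarrow> complex) \<Rightarrow> ('e \<Rightarrow> real \<Rightarrow> complex) \<Rightarrow> complex set set" where
  "faces M p \<gamma> = components (- (p ` verts M \<union> (\<Union>e\<in>edges M. path_image (\<gamma> e))))"

definition edge_faces ::
    "('v, 'e) mgraph \<Rightarrow> ('v \<Rightarrow> complex) \<Rightarrow> ('e \<Rightarrow> real \<Rightarrow> complex) \<Rightarrow> 'e \<Rightarrow> complex set set" where
  "edge_faces M p \<gamma> e = {f \<in> faces M p \<gamma>. open_edge \<gamma> e \<inter> frontier f \<noteq> {}}"

text \<open>The number of sides of the edge \<open>e\<close> on which the face \<open>f\<close> lies. The two sides of an edge
  of a plane drawing belong either to two different faces, each of them lying on one side, or to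
  one and the same face. So if \<open>f\<close> is the only face at \<open>e\<close>, it lies on both sides.\<close>

definition side_count ::
    "('v, 'e) mgraph \<Rightarrow> ('v \<Rightarrow> complex) \<Rightarrow> ('e \<Rightarrow> real \<Rightarrow> complex) \<Rightarrow> complex set \<Rightarrow> 'e \<Rightarrow> nat" where
  "side_count M p \<gamma> f e =
     (if f \<notin> edge_faces M p \<gamma> e then 0 else if edge_faces M p \<gamma> e = {f} then 2 else 1)"

definition face_degree ::
    "('v, 'e) mgraph \<Rightarrow> ('v \<Rightarrow> complex) \<Rightarrow> ('e \<Rightarrow> real \<Rightarrow> complex) \<Rightarrow> complex set \<Rightarrow> nat" where
  "face_degree M p \<gamma> f = (\<Sum>e\<in>edges M. side_count M p \<gamma> f e)"

end

theory Submission
  imports Defs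
begin

text \<open>All vertices lie on the real axis, consecutive ones are joined by segments of the axis, and every
  other edge is a parabola above or below it. Since no parabola joins consecutive vertices, the
  region below a parabola touches that parabola, an edge at its left end and another edge at its right
  end, so that no face has degree \<open>2\<close>. An induced forest has at most one vertex in a triangle with
  doubled edges and at most two in a \<open>K\<^sub>4\<close>. If \<open>k\<close> such triangles are nested such that each of
  the \<open>k + 2\<close> remaining 2-faces receives a \<open>K\<^sub>4\<close>, there are \<open>7 k + 8\<close> vertices and the bound
  \<open>k + 2 (k + 2) = 3 k + 4\<close> is attained.\<close>

section \<open>Drawings with all vertices on a line\<close>

text \<open>The faces are never determined, and no separation theorem for the plane enters. Every
  point off the drawing gets an explicit connected set that avoids the drawing and whose closure
  meets three open edges; the face of the point contains this set. Such sets can be written down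
  because all parabolas have the same leading coefficient up to sign: of two over nested intervals
  on one side, the wider one is farther from the axis, so regions between arcs are regions between
  graphs of continuous functions. The unbounded region is the obstacle: there one long parabola
  could hide all other edges of its side. Hence some segment of the axis must have no parabola over
  or under it. A triangle and a K4 together have 7 vertices and give 3 to the forest, whence the
  slope 3/7; the two additional K4 give 4 = (3/7) * 8 + 4/7, whence the constant.\<close>

definition bow :: "nat \<times> nat \<times> int \<Rightarrow> real \<Rightarrow> complex" where
  "bow = (\<lambda>(a, b, s) t. Complex (a + (real b - real a) * t)
     (of_int s * ((real b - real a)\<^sup>2 * t * (1 - t))))"

definition hgt :: "nat \<times> nat \<Rightarrow> real \<Rightarrow> real" where
  "hgt = (\<lambda>(a, b) x. (x - real a) * (real b - x))"

lemma bow_open_image: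
  assumes "a < b"
  shows "bow (a, b, s) ` {0<..<1} =
    {Complex x (of_int s * hgt (a, b) x) | x. real a < x \<and> x < real b}" (is "?L = ?R")
proof
  show "?L \<subseteq> ?R"
  proof
    fix z assume "z \<in> ?L"
    then obtain t where t: "0 < t" "t < 1" "z = bow (a, b, s) t" by auto
    let ?x = "a + (real b - real a) * t"
    have "z = Complex ?x (of_int s * hgt (a, b) ?x)"
      by (simp add: t bow_def hgt_def power2_eq_square algebra_simps)
    moreover have "real a < ?x" using t assms by simp
    moreover have "(real b - real a) * t < (real b - real a) * 1"
      using t assms by (intro mult_strict_left_mono) auto
    ultimately show "z \<in> ?R" by auto
  qed
  show "?R \<subseteq> ?L"
  proof
    fix z assume "z \<in> ?R"
    then obtain x where x: "real a < x" "x < real b" "z = Complex x (of_int s * hgt (a, b) x)" by auto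
    let ?t = "(x - a) / (real b - real a)"
    have "(real b - real a) * ?t = x - a" "(real b - real a) * (1 - ?t) = b - x"
      using assms by (simp_all add: field_simps)
    then have "hgt (a, b) x = ((real b - real a) * ?t) * ((real b - real a) * (1 - ?t))"
      "x = a + (real b - real a) * ?t"
      by (simp_all only: hgt_def case_prod_conv)
    then have "z = bow (a, b, s) ?t"
      unfolding x(3) bow_def case_prod_conv complex.inject power2_eq_square by (simp only: mult_ac)
    moreover have "?t \<in> {0<..<1}" using x assms by (simp add: field_simps)
    ultimately show "z \<in> ?L" by blast
  qed
qed

lemma arc_bow:
  assumes "a < b"
  shows "arc (bow (a, b, s))"
  unfolding arc_def path_def
proof
  show "continuous_on {0..1} (bow (a, b, s))"
    unfolding bow_def Complex_eq by (auto intro!: continuous_intros)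
  show "inj_on (bow (a, b, s)) {0..1}"
    using assms by (auto simp: inj_on_def bow_def)
qed

text \<open>Outside the inner interval the inner parabola is nonpositive and the outer one positive;
  inside, each factor of the inner height is bounded by the corresponding outer factor, one of them
  strictly. This turns nesting of intervals into disjointness of curves.\<close>

lemma hgt_nested:
  assumes "a \<le> c" "c < d" "d \<le> b" "real a < x" "x < real b"
  shows "hgt (c, d) x \<le> hgt (a, b) x"
    and "(c, d) \<noteq> (a, b) \<Longrightarrow> hgt (c, d) x < hgt (a, b) x"
proof -
  have pos: "0 < hgt (a, b) x" using assms by (simp add: hgt_def)
  consider "x \<le> c" | "x \<ge> d" | "c < x" "x < d" by linarith
  then have "hgt (c, d) x \<le> hgt (a, b) x \<and> ((c, d) \<noteq> (a, b) \<longrightarrow> hgt (c, d) x < hgt (a, b) x)"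
  proof cases
    case 1
    then have "hgt (c, d) x \<le> 0" using assms by (auto simp: hgt_def mult_nonpos_nonneg)
    then show ?thesis using pos by simp
  next
    case 2
    then have "hgt (c, d) x \<le> 0" using assms by (auto simp: hgt_def mult_nonneg_nonpos)
    then show ?thesis using pos by simp
  next
    case 3
    have ge: "x - c \<le> x - a" "d - x \<le> b - x" using assms by auto
    have "hgt (c, d) x \<le> hgt (a, b) x" using ge 3 by (auto simp: hgt_def intro: mult_mono)
    moreover have "hgt (c, d) x < hgt (a, b) x" if "(c, d) \<noteq> (a, b)"
    proof (cases "a = c")
      case True
      then have "d < b" using that assms by auto
      then show ?thesis using 3 True by (simp add: hgt_def)
    next
      case False
      then have "x - c < x - a" using assms by auto
      then have "(x - c) * (d - x) < (x - a) * (d - x)" using 3 by simp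
      also have "\<dots> \<le> (x - a) * (b - x)" using ge assms by (intro mult_left_mono) auto
      finally show ?thesis by (simp add: hgt_def)
    qed
    ultimately show ?thesis by blast
  qed
  then show "hgt (c, d) x \<le> hgt (a, b) x"
    and "(c, d) \<noteq> (a, b) \<Longrightarrow> hgt (c, d) x < hgt (a, b) x" by auto
qed

section \<open>Envelopes of parabolas and the regions they bound\<close>

text \<open>The function \<open>m\<close> is a floor: the axis itself for a region below a parabola,
  and a function that is negative beyond the outermost vertices for the unbounded region.\<close>

definition envelope :: "(real \<Rightarrow> real) \<Rightarrow> (nat \<times> nat) set \<Rightarrow> real \<Rightarrow> real" where
  "envelope m C x = Max (insert (m x) ((\<lambda>c. hgt c x) ` C))"

lemma continuous_on_envelope:
  assumes "finite C" "continuous_on UNIV m"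
  shows "continuous_on UNIV (envelope m C)"
  using assms(1)
proof (induction C rule: finite_induct)
  case empty
  then show ?case using assms by (simp add: envelope_def[abs_def])
next
  case (insert c C)
  have "envelope m (insert c C) = (\<lambda>x. max (hgt c x) (envelope m C x))"
  proof
    fix x
    have "insert (m x) ((\<lambda>c. hgt c x) ` insert c C) =
        insert (hgt c x) (insert (m x) ((\<lambda>c. hgt c x) ` C))" by auto
    then show "envelope m (insert c C) x = max (hgt c x) (envelope m C x)"
      unfolding envelope_def using insert by (subst Max_insert[symmetric]) auto
  qed
  moreover have "continuous_on UNIV (hgt c)"
    by (cases c) (auto simp: hgt_def intro!: continuous_intros)
  ultimately show ?case using insert.IH by (auto intro!: continuous_intros)
qed

lemma envelope_less_iff:
  "finite C \<Longrightarrow> envelope m C x < y \<longleftrightarrow> m x < y \<and> (\<forall>c\<in>C. hgt c x < y)"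
  by (auto simp: envelope_def)

lemma envelope_ge:
  "finite C \<Longrightarrow> m x \<le> envelope m C x"
  by (simp add: envelope_def)

lemma envelope_cases:
  assumes "finite C"
  obtains "envelope m C x = m x" | c where "c \<in> C" "envelope m C x = hgt c x"
proof -
  have "envelope m C x \<in> insert (m x) ((\<lambda>c. hgt c x) ` C)"
    unfolding envelope_def using assms by (intro Max_in) auto
  then show thesis using that by blast
qed

text \<open>The region between the graphs of \<open>L\<close> and \<open>L + D\<close> (for
  \<open>T\<close> the open unit interval) or beyond the graph of \<open>L\<close> (for
  \<open>T\<close> the positive reals and \<open>D = 1\<close>). As a continuous image of a product
  it is visibly connected.\<close>

definition band :: "int \<Rightarrow> (real \<Rightarrow> real) \<Rightarrow> (real \<Rightarrow> real) \<Rightarrow> real set \<Rightarrow> real set \<Rightarrow> complex set" where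
  "band s L D J T = (\<lambda>(x, t). Complex x (of_int s * (L x + t * D x))) ` (J \<times> T)"

lemma connected_band:
  assumes "continuous_on UNIV L" "continuous_on UNIV D" "connected J" "connected T"
  shows "connected (band s L D J T)"
  unfolding band_def
proof (rule connected_continuous_image)
  have *: "continuous_on (J \<times> T) (\<lambda>p. L (fst p))" "continuous_on (J \<times> T) (\<lambda>p. D (fst p))"
    using assms(1,2)
    by (auto intro!: continuous_on_compose2[where f = fst] continuous_intros elim: continuous_on_subset)
  then show "continuous_on (J \<times> T) (\<lambda>(x, t). Complex x (of_int s * (L x + t * D x)))"
    unfolding Complex_eq case_prod_unfold by (intro continuous_intros)
  show "connected (J \<times> T)" using assms by (intro connected_Times)
qed

text \<open>Moving along a vertical fibre, the parameters 0 and 1 are limits of \<open>T\<close>,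
  which puts the bounding curves into the closure of an open band.\<close>

lemma closure_band:
  assumes "x \<in> J" "t \<in> closure T"
  shows "Complex x (of_int s * (L x + t * D x)) \<in> closure (band s L D J T)"
proof -
  let ?f = "\<lambda>t. Complex x (of_int s * (L x + t * D x))"
  have "continuous_on (closure T) ?f"
    unfolding Complex_eq by (intro continuous_intros)
  then have "?f ` closure T \<subseteq> closure (band s L D J T)"
  proof (rule image_closure_subset)
    have "?f ` T \<subseteq> band s L D J T" using assms(1) by (auto simp: band_def)
    then show "?f ` T \<subseteq> closure (band s L D J T)" using closure_subset by blast
  qed simp
  then show ?thesis using assms by blast
qed

text \<open>Connectedness forces \<open>R\<close> into \<open>f\<close>. A point of an edge in the
  closure of \<open>R\<close> is thus in the closure of \<open>f\<close> but not in
  \<open>f\<close>, hence on its frontier, and the edge counts at least once.\<close>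

lemma face_degree_ge_3:
  assumes M: "finite (edges M)" and f: "f \<in> faces M p \<gamma>"
    and R: "connected R" "R \<inter> f \<noteq> {}"
      "R \<inter> (p ` verts M \<union> (\<Union>e\<in>edges M. path_image (\<gamma> e))) = {}"
    and X: "X \<subseteq> edges M" "card X = 3" "\<And>e. e \<in> X \<Longrightarrow> open_edge \<gamma> e \<inter> closure R \<noteq> {}"
  shows "3 \<le> face_degree M p \<gamma> f"
proof -
  let ?D = "p ` verts M \<union> (\<Union>e\<in>edges M. path_image (\<gamma> e))"
  have fc: "f \<in> components (- ?D)" using f by (simp add: faces_def)
  then have fsub: "f \<subseteq> - ?D" by (rule in_components_subset)
  have "R \<subseteq> f"
    by (rule components_maximal[OF fc R(1)]) (use R in auto)
  then have cl: "closure R \<subseteq> closure f" by (rule closure_mono)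
  have side: "1 \<le> side_count M p \<gamma> f e" if "e \<in> X" for e
  proof -
    obtain z where z: "z \<in> open_edge \<gamma> e" "z \<in> closure R" using X(3)[OF \<open>e \<in> X\<close>] by blast
    have "z \<in> path_image (\<gamma> e)" using z(1) by (auto simp: open_edge_def path_image_def)
    then have "z \<notin> f" using fsub that X(1) by blast
    then have "z \<in> frontier f"
      using z(2) cl interior_subset[of f] by (auto simp: frontier_def)
    then have "f \<in> edge_faces M p \<gamma> e" using f z by (auto simp: edge_faces_def)
    then show ?thesis by (simp add: side_count_def)
  qed
  have "3 = (\<Sum>e\<in>X. 1::nat)" using X by simp
  also have "\<dots> \<le> (\<Sum>e\<in>X. side_count M p \<gamma> f e)" by (rule sum_mono) (use side in auto)
  also have "\<dots> \<le> face_degree M p \<gamma> f"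
    unfolding face_degree_def by (rule sum_mono2) (use M X in auto)
  finally show ?thesis .
qed

lemma bow_path_image:
  assumes "a < b"
  shows "path_image (bow (a, b, s)) =
    {Complex x (of_int s * hgt (a, b) x) | x. real a \<le> x \<and> x \<le> real b}"
proof -
  have *: "{0..1::real} = insert 0 (insert 1 {0<..<1})" by auto
  have "path_image (bow (a, b, s)) = {Complex a 0, Complex b 0} \<union>
    {Complex x (of_int s * hgt (a, b) x) | x. real a < x \<and> x < real b}"
    unfolding path_image_def * bow_open_image[OF assms, of s, symmetric]
    by (auto simp: bow_def)
  also have "\<dots> = {Complex x (of_int s * hgt (a, b) x) | x. real a \<le> x \<and> x \<le> real b}"
  proof -
    have "Complex a 0 = Complex a (of_int s * hgt (a, b) a)"
      "Complex b 0 = Complex b (of_int s * hgt (a, b) b)"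
      by (auto simp: hgt_def)
    moreover have "real a \<le> b" using assms by simp
    moreover have "{Complex x (of_int s * hgt (a, b) x) | x. real a \<le> x \<and> x \<le> real b} =
        {Complex x (of_int s * hgt (a, b) x) | x. x = a \<or> x = b \<or> real a < x \<and> x < real b}"
      using \<open>real a \<le> b\<close> by (intro Collect_cong ex_cong1) auto
    ultimately show ?thesis by auto
  qed
  finally show ?thesis .
qed

text \<open>The edge \<open>(a, b, s)\<close> joins \<open>a < b\<close>; it is drawn as a parabola above (\<open>s = 1\<close>) or below
  (\<open>s = -1\<close>) the real axis, or as a segment of the axis (\<open>s = 0\<close>).\<close>

locale book =
  fixes n :: nat and E :: "(nat \<times> nat \<times> int) set" and g :: nat
  assumes E_bounds: "(a, b, s) \<in> E \<Longrightarrow> a < b \<and> b < n \<and> s \<in> {-1, 0, 1}"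
    and axis: "Suc j < n \<Longrightarrow> (j, Suc j, 0) \<in> E"
    and axis_only: "(a, b, 0) \<in> E \<Longrightarrow> b = Suc a"
    and long: "(a, b, s) \<in> E \<Longrightarrow> s \<noteq> 0 \<Longrightarrow> Suc a < b"
    and noncrossing: "(a, b, s) \<in> E \<Longrightarrow> (c, d, s) \<in> E \<Longrightarrow> s \<noteq> 0 \<Longrightarrow>
      b \<le> c \<or> d \<le> a \<or> a \<le> c \<and> d \<le> b \<or> c \<le> a \<and> b \<le> d"
    and gap: "0 < g" "Suc (Suc g) < n" "(a, b, s) \<in> E \<Longrightarrow> a \<le> g \<Longrightarrow> g < b \<Longrightarrow> s = 0"
begin

section \<open>The plane embedding of a book\<close>

text \<open>Triples are encoded by \<open>to_nat\<close> because the theorem asks for edges of type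
  \<open>nat\<close>.\<close>

definition graph :: "(nat, nat) mgraph" where
  "graph = \<lparr>verts = {..<n}, edges = to_nat ` E, ends = (\<lambda>e. case from_nat e of (a, b, s :: int) \<Rightarrow> {a, b})\<rparr>"

definition position :: "nat \<Rightarrow> complex" where
  "position j = Complex (real j) 0"

definition curve :: "nat \<Rightarrow> real \<Rightarrow> complex" where
  "curve e = bow (from_nat e)"

definition drawing :: "complex set" where
  "drawing = position ` verts graph \<union> (\<Union>e\<in>edges graph. path_image (curve e))"

lemma graph_simps [simp]:
  "verts graph = {..<n}" "edges graph = to_nat ` E" "ends graph (to_nat (a, b, s :: int)) = {a, b}"
  "curve (to_nat e) = bow e"
  by (auto simp: graph_def curve_def)

lemma finite_E: "finite E"
proof (rule finite_subset)
  show "E \<subseteq> {..<n} \<times> {..<n} \<times> {-1, 0, 1}"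
  proof
    fix e assume "e \<in> E"
    then show "e \<in> {..<n} \<times> {..<n} \<times> {-1, 0, 1}"
      using E_bounds by (cases e) fastforce
  qed
qed auto

lemma multigraph_graph: "multigraph graph"
  unfolding multigraph_def
proof (intro conjI ballI)
  fix e assume "e \<in> edges graph"
  then obtain a b s where e: "(a, b, s) \<in> E" "e = to_nat (a, b, s)" by auto
  show "ends graph e \<subseteq> verts graph" "card (ends graph e) = 2"
    using E_bounds[OF e(1)] e(2) by auto
qed (use finite_E in auto)

lemma hgt_pos: "real a < x \<Longrightarrow> x < real b \<Longrightarrow> 0 < hgt (a, b) x"
  by (simp add: hgt_def)

text \<open>Both heights are positive at \<open>x\<close>, so different sides give different signs.
  Two axis edges over \<open>x\<close> are the same unit segment. On a common side
  \<open>noncrossing\<close> leaves only nested intervals, where the heights differ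
  strictly.\<close>

lemma open_edges_disjoint:
  fixes x :: real
  assumes e: "(a, b, s) \<in> E" "(c, d, t) \<in> E" "(a, b, s) \<noteq> (c, d, t)"
    and x: "a < x" "x < b" "c < x" "x < d"
  shows "of_int s * hgt (a, b) x \<noteq> of_int t * hgt (c, d) x"
proof (cases "s = t")
  case False
  then show ?thesis
    using E_bounds[OF e(1)] E_bounds[OF e(2)] hgt_pos[OF x(1,2)] hgt_pos[OF x(3,4)] by auto
next
  case st: True
  show ?thesis
  proof (cases "s = 0")
    case True
    then have "b = Suc a" "d = Suc c" using axis_only e st by auto
    then have "a = c" using x by linarith
    then show ?thesis using e(3) st \<open>b = Suc a\<close> \<open>d = Suc c\<close> by simp
  next
    case False
    consider "a \<le> c" "d \<le> b" | "c \<le> a" "b \<le> d"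
      using noncrossing[OF e(1) e(2)[folded st] False] x by linarith
    then have "hgt (a, b) x \<noteq> hgt (c, d) x"
    proof cases
      case 1
      then have "hgt (c, d) x < hgt (a, b) x"
        using E_bounds[OF e(2)] e(3) st x by (intro hgt_nested) auto
      then show ?thesis by simp
    next
      case 2
      then have "hgt (a, b) x < hgt (c, d) x"
        using E_bounds[OF e(1)] e(3) st x by (intro hgt_nested) auto
      then show ?thesis by simp
    qed
    then show ?thesis using False st by simp
  qed
qed

lemma plane_embedding_graph: "plane_embedding graph position curve"
  unfolding plane_embedding_def
proof (intro conjI ballI impI)
  show "inj_on position (verts graph)" by (auto simp: inj_on_def position_def)
next
  fix e assume "e \<in> edges graph"
  then obtain a b s where e: "(a, b, s) \<in> E" "e = to_nat (a, b, s)" by auto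
  note ab = E_bounds[OF e(1)]
  show "arc (curve e)" using e ab by (auto intro: arc_bow)
  show "{pathstart (curve e), pathfinish (curve e)} = position ` ends graph e"
    by (auto simp: e(2) pathstart_def pathfinish_def bow_def position_def)
  show "open_edge curve e \<inter> position ` verts graph = {}"
  proof -
    have False if "real a < real j" "real j < real b" "of_int s * hgt (a, b) j = 0" for j :: nat
    proof -
      have "s = 0" using hgt_pos[OF that(1,2)] that(3) by simp
      then have "b = Suc a" using axis_only e by blast
      then show False using that by simp
    qed
    then show ?thesis
      using ab by (auto simp: e(2) open_edge_def bow_open_image position_def)
  qed
next
  fix e e' assume "e \<in> edges graph" "e' \<in> edges graph" "e \<noteq> e'"
  then obtain a b s c d t where e: "(a, b, s) \<in> E" "e = to_nat (a, b, s)"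
    "(c, d, t) \<in> E" "e' = to_nat (c, d, t)" "(a, b, s) \<noteq> (c, d, t)" by auto
  then show "open_edge curve e \<inter> open_edge curve e' = {}"
    using open_edges_disjoint[OF e(1,3,5)] E_bounds[OF e(1)] E_bounds[OF e(3)]
    by (auto simp: open_edge_def bow_open_image)
qed

text \<open>Every vertex is an end of an axis segment, so vertices need no case of their own and
  membership becomes a condition on real coordinates.\<close>

lemma drawing_iff:
  "z \<in> drawing \<longleftrightarrow>
    (\<exists>a b s. (a, b, s) \<in> E \<and> a \<le> Re z \<and> Re z \<le> b \<and> Im z = of_int s * hgt (a, b) (Re z))"
    (is "?l \<longleftrightarrow> ?r")
proof
  assume ?l
  then consider j where "j < n" "z = position j"
    | a b s where "(a, b, s) \<in> E" "z \<in> path_image (bow (a, b, s))"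
    unfolding drawing_def by force
  then show ?r
  proof cases
    case 1
    have "\<exists>i. Suc i < n \<and> (j = i \<or> j = Suc i)"
    proof (cases j)
      case 0
      then show ?thesis using gap by auto
    next
      case (Suc i)
      then show ?thesis using 1 by auto
    qed
    then obtain i where "Suc i < n" "j = i \<or> j = Suc i" by blast
    then show ?thesis using axis[of i] 1
      by (intro exI[of _ i] exI[of _ "Suc i"] exI[of _ 0]) (auto simp: position_def)
  next
    case 2
    then obtain x :: real where "z = Complex x (of_int s * hgt (a, b) x)" "a \<le> x" "x \<le> b"
      using E_bounds[OF 2(1)] by (auto simp: bow_path_image)
    then show ?thesis using 2(1) by (intro exI[of _ a] exI[of _ b] exI[of _ s]) simp
  qed
next
  assume ?r
  then obtain a b s where e: "(a, b, s) \<in> E" "a \<le> Re z" "Re z \<le> b"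
    "Im z = of_int s * hgt (a, b) (Re z)" by blast
  then have "z \<in> path_image (bow (a, b, s))"
    using E_bounds[OF e(1)] by (auto simp: bow_path_image complex_eq_iff)
  then show ?l unfolding drawing_def using e(1) by force
qed

lemma between_consecutive:
  fixes x :: real
  assumes "0 \<le> x" "x \<le> real n - 1"
  shows "\<exists>j. Suc j < n \<and> j \<le> x \<and> x \<le> Suc j"
proof (cases "x = real n - 1")
  case True
  \<comment> \<open>The last vertex has no right neighbour, so rounding down would fail here; it is
    the right end of the last segment.\<close>
  then show ?thesis using gap by (intro exI[of _ "n - 2"]) auto
next
  case False
  let ?j = "nat \<lfloor>x\<rfloor>"
  have "real ?j \<le> x" "x < real ?j + 1" using assms by linarith+
  then show ?thesis using assms False by (intro exI[of _ ?j]) linarith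
qed

lemma hgt_half:
  assumes "0 \<le> hgt (c, d) (real j + 1 / 2)"
  shows "c \<le> j \<and> j < d \<or> d \<le> j \<and> j < c"
  using assms by (auto simp: hgt_def zero_le_mult_iff)

section \<open>Regions whose closure meets three edges\<close>

text \<open>The midpoint of \<open>[j, j + 1]\<close> avoids all vertices, so the envelope there
  lies on an open edge: the axis segment if the floor is attained, otherwise an arc of nonnegative
  height, which must span the whole segment because its ends are integers. Recording the span allows
  edges found at different midpoints to be told apart.\<close>

lemma touched_edge:
  assumes C: "C \<subseteq> {(c, d). (c, d, s) \<in> E}" and j: "Suc j < n" and m: "m (real j + 1 / 2) = 0"
  obtains c d t where "(c, d, t) \<in> E" "c \<le> j" "j < d" "t = 0 \<or> t = s \<and> (c, d) \<in> C"
    "Complex (real j + 1 / 2) (of_int s * envelope m C (real j + 1 / 2)) \<in> bow (c, d, t) ` {0<..<1}"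
proof -
  let ?x = "real j + 1 / 2"
  have "C \<subseteq> (\<lambda>(c, d, s). (c, d)) ` E" using C by force
  then have fC: "finite C" using finite_E finite_surj by blast
  show thesis
    using fC
  proof (cases rule: envelope_cases[of C m ?x])
    case 1
    then show thesis
      using j m axis[of j] by (intro that[of j "Suc j" 0]) (auto simp: bow_open_image)
  next
    case (2 c)
    obtain a b where c: "c = (a, b)" by fastforce
    have E: "(a, b, s) \<in> E" using 2 C c by auto
    have "0 \<le> hgt (a, b) ?x"
      using 2 envelope_ge[OF fC, of m ?x] m c by simp
    then have "a \<le> j" "j < b" using hgt_half E_bounds[OF E] by force+
    then show thesis
      using 2 c E E_bounds[OF E] by (intro that[of a b s]) (auto simp: bow_open_image)
  qed
qed

lemma card_edges_3:
  assumes "e1 \<noteq> e2" "e1 \<noteq> e3" "e2 \<noteq> e3"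
  shows "card {e1, e2, e3} = 3"
  using assms by simp

text \<open>No face is mentioned: whichever face meets such a set contains it and has degree at
  least 3.\<close>

definition rich :: "complex set \<Rightarrow> bool" where
  "rich R \<longleftrightarrow> connected R \<and> R \<inter> drawing = {} \<and>
     (\<exists>X\<subseteq>E. card X = 3 \<and> (\<forall>e\<in>X. bow e ` {0<..<1} \<inter> closure R \<noteq> {}))"

text \<open>By \<open>minimal\<close>, the point lies between \<open>(a, b)\<close> and the envelope
  of the arcs properly nested in it; \<open>R\<close> is the full region between these two graphs.
  Strict nesting makes its thickness \<open>D\<close> positive over the whole open interval.\<close>

lemma inner_region:
  assumes s: "s = 1 \<or> s = -1" and e: "(a, b, s) \<in> E" and z: "z \<notin> drawing"
    and pos: "0 < of_int s * Im z" and x: "a < Re z" "Re z < b"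
    and below: "of_int s * Im z < hgt (a, b) (Re z)"
    and minimal: "\<And>c d. (c, d, s) \<in> E \<Longrightarrow> a \<le> c \<Longrightarrow> d \<le> b \<Longrightarrow> (c, d) \<noteq> (a, b) \<Longrightarrow>
      c < Re z \<Longrightarrow> Re z < d \<Longrightarrow> hgt (c, d) (Re z) \<le> of_int s * Im z"
  shows "\<exists>R. z \<in> R \<and> rich R"
proof -
  define C where "C = {(c, d). (c, d, s) \<in> E \<and> a \<le> c \<and> d \<le> b \<and> (c, d) \<noteq> (a, b)}"
  have C: "C \<subseteq> {(c, d). (c, d, s) \<in> E}" by (auto simp: C_def)
  have "C \<subseteq> (\<lambda>(c, d, s). (c, d)) ` E" using C by force
  then have fC: "finite C" using finite_E finite_surj by blast
  define L where "L = envelope (\<lambda>_. 0) C"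
  define D where "D = (\<lambda>x. hgt (a, b) x - L x)"
  define R where "R = band s L D {real a<..<real b} {0<..<1}"
  have ss: "of_int s * (of_int s * r) = r" for r :: real using s by auto
  have ab: "Suc a < b" "b < n" using long[OF e] E_bounds[OF e] s by auto
  have cL: "continuous_on UNIV L"
    unfolding L_def by (intro continuous_on_envelope fC continuous_intros)
  have cD: "continuous_on UNIV D"
    unfolding D_def hgt_def prod.case by (intro continuous_intros cL)
  have Dpos: "0 < D x" if "real a < x" "x < real b" for x
  proof -
    have "hgt c x < hgt (a, b) x" if "c \<in> C" for c
      using that \<open>a < x\<close> \<open>x < b\<close> E_bounds by (auto simp: C_def intro!: hgt_nested)
    then show ?thesis
      unfolding D_def L_def using fC hgt_pos[OF that] by (simp add: envelope_less_iff)
  qed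
  have R_iff: "w \<in> R \<longleftrightarrow> a < Re w \<and> Re w < b \<and> L (Re w) < of_int s * Im w \<and>
      of_int s * Im w < hgt (a, b) (Re w)" (is "_ \<longleftrightarrow> ?P") for w
  proof
    assume "w \<in> R"
    then obtain x t :: real where w: "w = Complex x (of_int s * (L x + t * D x))"
      "a < x" "x < b" "0 < t" "t < 1" unfolding R_def band_def by force
    have "0 < t * D x" using w Dpos by simp
    moreover have "t * D x < D x" using w Dpos by simp
    ultimately show ?P using w by (simp add: ss D_def)
  next
    assume P: ?P
    let ?t = "(of_int s * Im w - L (Re w)) / D (Re w)"
    have D: "0 < D (Re w)" using P Dpos by blast
    then have t: "?t \<in> {0<..<1}" using P by (auto simp: D_def)
    have "w = Complex (Re w) (of_int s * (L (Re w) + ?t * D (Re w)))"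
      using D by (simp add: ss complex_eq_iff)
    then show "w \<in> R" unfolding R_def band_def using t P
      by (intro image_eqI[where x = "(Re w, ?t)"]) auto
  qed
  have zR: "z \<in> R"
  proof -
    have "hgt c (Re z) < of_int s * Im z" if "c \<in> C" for c
    proof -
      obtain p q where c: "c = (p, q)" "(p, q, s) \<in> E" "a \<le> p" "q \<le> b" "(p, q) \<noteq> (a, b)"
        using \<open>c \<in> C\<close> unfolding C_def by blast
      show ?thesis
      proof (cases "p < Re z \<and> Re z < q")
        case True
        then have "hgt (p, q) (Re z) \<le> of_int s * Im z" using minimal c by blast
        moreover have "hgt (p, q) (Re z) \<noteq> of_int s * Im z"
        proof
          assume "hgt (p, q) (Re z) = of_int s * Im z"
          then have "Im z = of_int s * hgt (p, q) (Re z)" by (simp add: ss)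
          then have "z \<in> drawing" unfolding drawing_iff using c True by fastforce
          then show False using z by blast
        qed
        ultimately show ?thesis using c by simp
      next
        case False
        then have "hgt (p, q) (Re z) \<le> 0"
          using E_bounds[OF c(2)]
          by (auto simp: hgt_def mult_le_0_iff)
        then show ?thesis using pos c by simp
      qed
    qed
    then have "L (Re z) < of_int s * Im z"
      unfolding L_def using fC pos by (simp add: envelope_less_iff)
    then show ?thesis using R_iff x below by blast
  qed
  have RD: "R \<inter> drawing = {}"
  proof (rule equals0I)
    fix w assume "w \<in> R \<inter> drawing"
    then obtain c d t where w: "w \<in> R" "(c, d, t) \<in> E" "c \<le> Re w" "Re w \<le> d"
      "Im w = of_int t * hgt (c, d) (Re w)" by (auto simp: drawing_iff)
    note P = w(1)[unfolded R_iff]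
    have h0: "0 \<le> hgt (c, d) (Re w)" using w by (simp add: hgt_def)
    have Lw: "0 < of_int s * Im w" "\<And>c. c \<in> C \<Longrightarrow> hgt c (Re w) < of_int s * Im w"
      using P fC unfolding L_def by (auto simp: envelope_less_iff)
    \<comment> \<open>Points of \<open>R\<close> lie strictly beyond the floor 0 on side
      \<open>s\<close>, out of reach of the axis and of the other side.\<close>
    have ts: "t = s"
    proof (rule ccontr)
      assume "t \<noteq> s"
      then have "of_int s * of_int t \<le> (0 :: real)" using s E_bounds[OF w(2)] by auto
      then have "of_int s * Im w \<le> 0"
        unfolding w(5) using h0 by (simp add: mult.assoc[symmetric] mult_nonpos_nonneg)
      then show False using Lw by simp
    qed
    then have sw: "of_int s * Im w = hgt (c, d) (Re w)" using w by (simp add: ss)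
    have "0 < hgt (c, d) (Re w)" using Lw sw by simp
    then have cd: "c < Re w" "Re w < d" using w by (auto simp: hgt_def less_le)
    have "s \<noteq> 0" using s by auto
    \<comment> \<open>An arc over a point of \<open>R\<close> is either nested in
      \<open>(a, b)\<close>, hence below \<open>R\<close> or equal to its upper boundary, or
      encloses \<open>(a, b)\<close>, hence not below that boundary.\<close>
    consider "a \<le> c" "d \<le> b" | "c \<le> a" "b \<le> d"
      using noncrossing[OF e w(2)[unfolded ts] \<open>s \<noteq> 0\<close>] P cd by linarith
    then show False
    proof cases
      case 1
      then have "(c, d) \<in> C \<or> (c, d) = (a, b)" using w ts unfolding C_def by blast
      then show False using Lw(2) sw P by force
    next
      case 2
      then have "hgt (a, b) (Re w) \<le> hgt (c, d) (Re w)"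
        using P ab by (intro hgt_nested) auto
      then show False using sw P by simp
    qed
  qed
  have closure_L: "Complex x (of_int s * L x) \<in> closure R" if "real a < x" "x < real b" for x
    using closure_band[of x "{real a<..<real b}" 0 "{0<..<1}" s L D] that by (simp add: R_def)
  have closure_U: "Complex x (of_int s * hgt (a, b) x) \<in> closure R" if "real a < x" "x < real b" for x
    using closure_band[of x "{real a<..<real b}" 1 "{0<..<1}" s L D] that by (simp add: R_def D_def)
  obtain c d t where e1: "(c, d, t) \<in> E" "c \<le> a" "a < d" "t = 0 \<or> t = s \<and> (c, d) \<in> C"
    "Complex (real a + 1 / 2) (of_int s * L (real a + 1 / 2)) \<in> bow (c, d, t) ` {0<..<1}"
    by (rule touched_edge[OF C, of a "\<lambda>_. 0"]) (use ab in \<open>auto simp: L_def\<close>)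
  obtain c' d' t' where e2: "(c', d', t') \<in> E" "c' \<le> b - 1" "b - 1 < d'" "t' = 0 \<or> t' = s \<and> (c', d') \<in> C"
    "Complex (real (b - 1) + 1 / 2) (of_int s * L (real (b - 1) + 1 / 2)) \<in> bow (c', d', t') ` {0<..<1}"
    by (rule touched_edge[OF C, of "b - 1" "\<lambda>_. 0"]) (use ab in \<open>auto simp: L_def\<close>)
  have ne: "(c, d, t) \<noteq> (a, b, s)" "(c', d', t') \<noteq> (a, b, s)"
    using e1(4) e2(4) s by (auto simp: C_def)
  \<comment> \<open>A common edge would span both the first and the last unit segment of
    \<open>[a, b]\<close>. An axis segment is too short, as \<open>Suc a < b\<close>, and an arc
    from \<open>C\<close> would have to be \<open>(a, b)\<close> itself.\<close>
  have "(c, d, t) \<noteq> (c', d', t')"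
  proof
    assume eq: "(c, d, t) = (c', d', t')"
    show False
    proof (cases "t = 0")
      case True
      then show False using axis_only[of c d] e1 e2 eq ab by auto
    next
      case False
      then show False using e1 e2 eq ab by (auto simp: C_def)
    qed
  qed
  then have card: "card {(c, d, t), (c', d', t'), (a, b, s)} = 3"
    using ne by (intro card_edges_3) auto
  have "Complex (real a + 1 / 2) (of_int s * hgt (a, b) (real a + 1 / 2)) \<in> bow (a, b, s) ` {0<..<1}"
    using ab by (auto simp: bow_open_image)
  moreover have "Complex (real a + 1 / 2) (of_int s * hgt (a, b) (real a + 1 / 2)) \<in> closure R"
    "Complex (real a + 1 / 2) (of_int s * L (real a + 1 / 2)) \<in> closure R"
    "Complex (real (b - 1) + 1 / 2) (of_int s * L (real (b - 1) + 1 / 2)) \<in> closure R"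
    using ab by (intro closure_L closure_U; simp)+
  ultimately have "\<forall>e\<in>{(c, d, t), (c', d', t'), (a, b, s)}. bow e ` {0<..<1} \<inter> closure R \<noteq> {}"
    using e1(5) e2(5) by blast
  moreover have "connected R"
    unfolding R_def by (intro connected_band cL cD) auto
  ultimately have "rich R"
    unfolding rich_def using RD card e e1(1) e2(1)
    by (intro conjI exI[of _ "{(c, d, t), (c', d', t'), (a, b, s)}"]) auto
  then show ?thesis using zR by blast
qed

text \<open>No arc of its side is above the point, so \<open>R\<close> is everything beyond the
  envelope of that side. Midpoints in the first segment, the last segment and the segment at
  \<open>g\<close> yield the three edges; \<open>gap\<close> prevents one arc from covering all
  three.\<close>

lemma outer_region:
  assumes s: "s = 1 \<or> s = -1" and z: "z \<notin> drawing"
    and nonneg: "0 \<le> of_int s * Im z"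
    and above: "\<And>c d. (c, d, s) \<in> E \<Longrightarrow> c < Re z \<Longrightarrow> Re z < d \<Longrightarrow> hgt (c, d) (Re z) \<le> of_int s * Im z"
  shows "\<exists>R. z \<in> R \<and> rich R"
proof -
  define C where "C = {(c, d). (c, d, s) \<in> E}"
  have C: "C \<subseteq> {(c, d). (c, d, s) \<in> E}" by (auto simp: C_def)
  have "C \<subseteq> (\<lambda>(c, d, s). (c, d)) ` E" using C by force
  then have fC: "finite C" using finite_E finite_surj by blast
  \<comment> \<open>Zero between the outermost vertices and negative beyond them, so that
    \<open>R\<close> also contains the points of the axis outside the drawing.\<close>
  define m where "m = (\<lambda>x. min 0 (hgt (0, n - 1) x))"
  define L where "L = envelope m C"
  define R where "R = band s L (\<lambda>_. 1) UNIV {0<..}"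
  have ss: "of_int s * (of_int s * r) = r" for r :: real using s by auto
  have cm: "continuous_on UNIV m" unfolding m_def hgt_def prod.case by (intro continuous_intros)
  have cL: "continuous_on UNIV L"
    unfolding L_def by (intro continuous_on_envelope fC cm)
  have m0: "m x = 0" if "0 \<le> x" "x \<le> real n - 1" for x
    using that gap by (auto simp: m_def hgt_def of_nat_diff)
  have R_iff: "w \<in> R \<longleftrightarrow> L (Re w) < of_int s * Im w" for w
  proof
    assume "w \<in> R"
    then show "L (Re w) < of_int s * Im w" by (auto simp: R_def band_def ss)
  next
    assume P: "L (Re w) < of_int s * Im w"
    let ?t = "of_int s * Im w - L (Re w)"
    have "w = Complex (Re w) (of_int s * (L (Re w) + ?t * 1))"
      by (simp add: ss complex_eq_iff)
    then show "w \<in> R" unfolding R_def band_def using P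
      by (intro image_eqI[where x = "(Re w, ?t)"]) auto
  qed
  have mz: "m (Re z) < of_int s * Im z"
  proof (cases "0 \<le> Re z \<and> Re z \<le> real n - 1")
    case True
    then obtain j where j: "Suc j < n" "j \<le> Re z" "Re z \<le> Suc j" using between_consecutive by blast
    have "Im z \<noteq> 0"
    proof
      assume "Im z = 0"
      then have "z \<in> drawing" unfolding drawing_iff using axis[OF j(1)] j by fastforce
      then show False using z by blast
    qed
    then show ?thesis using m0 True nonneg s by auto
  next
    case False
    then have "hgt (0, n - 1) (Re z) < 0"
      using gap by (auto simp: hgt_def mult_less_0_iff of_nat_diff)
    then show ?thesis using nonneg by (simp add: m_def)
  qed
  have zR: "z \<in> R"
  proof -
    have "hgt c (Re z) < of_int s * Im z" if "c \<in> C" for c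
    proof -
      obtain p q where c: "c = (p, q)" "(p, q, s) \<in> E"
        using \<open>c \<in> C\<close> unfolding C_def by blast
      note pq = E_bounds[OF c(2)]
      consider "p < Re z" "Re z < q" | "Re z = p \<or> Re z = q" | "Re z < p \<or> Re z > q" by linarith
      then show ?thesis
      proof cases
        case 1
        then have "hgt (p, q) (Re z) \<le> of_int s * Im z" using above c by blast
        moreover have "hgt (p, q) (Re z) \<noteq> of_int s * Im z"
        proof
          assume "hgt (p, q) (Re z) = of_int s * Im z"
          then have "Im z = of_int s * hgt (p, q) (Re z)" by (simp add: ss)
          then have "z \<in> drawing" unfolding drawing_iff using c 1 by fastforce
          then show False using z by blast
        qed
        ultimately show ?thesis using c by simp
      next
        case 2
        then have "hgt (p, q) (Re z) = 0" "m (Re z) = 0"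
          using pq by (auto simp: hgt_def intro!: m0)
        then show ?thesis using mz c by simp
      next
        case 3
        then have "hgt (p, q) (Re z) < 0"
          using pq by (auto simp: hgt_def mult_less_0_iff)
        then show ?thesis using nonneg c by simp
      qed
    qed
    then have "L (Re z) < of_int s * Im z"
      unfolding L_def using fC mz by (simp add: envelope_less_iff)
    then show ?thesis using R_iff by blast
  qed
  have RD: "R \<inter> drawing = {}"
  proof (rule equals0I)
    fix w assume "w \<in> R \<inter> drawing"
    then obtain c d t where w: "w \<in> R" "(c, d, t) \<in> E" "c \<le> Re w" "Re w \<le> d"
      "Im w = of_int t * hgt (c, d) (Re w)" by (auto simp: drawing_iff)
    note P = w(1)[unfolded R_iff]
    have h0: "0 \<le> hgt (c, d) (Re w)" using w by (simp add: hgt_def)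
    have "m (Re w) = 0" using w E_bounds[OF w(2)] by (intro m0) auto
    then have Lw: "0 < of_int s * Im w" "\<And>c. c \<in> C \<Longrightarrow> hgt c (Re w) < of_int s * Im w"
      using P fC unfolding L_def by (auto simp: envelope_less_iff)
    have ts: "t = s"
    proof (rule ccontr)
      assume "t \<noteq> s"
      then have "of_int s * of_int t \<le> (0 :: real)" using s E_bounds[OF w(2)] by auto
      then have "of_int s * Im w \<le> 0"
        unfolding w(5) using h0 by (simp add: mult.assoc[symmetric] mult_nonpos_nonneg)
      then show False using Lw by simp
    qed
    then have "of_int s * Im w = hgt (c, d) (Re w)" using w by (simp add: ss)
    moreover have "(c, d) \<in> C" using w ts by (simp add: C_def)
    ultimately show False using Lw(2) by force
  qed
  have closure_L: "Complex x (of_int s * L x) \<in> closure R" for x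
    using closure_band[of x UNIV 0 "{0<..}" s L "\<lambda>_. 1"] by (simp add: R_def)
  have touched: thesis if "Suc j < n" "\<And>c d t. (c, d, t) \<in> E \<Longrightarrow> c \<le> j \<Longrightarrow> j < d \<Longrightarrow>
      bow (c, d, t) ` {0<..<1} \<inter> closure R \<noteq> {} \<Longrightarrow> thesis" for j thesis
  proof -
    have m: "m (real j + 1 / 2) = 0" using that(1) by (intro m0) auto
    show thesis
      by (rule touched_edge[where m = m, OF C that(1) m]) (use that(2) closure_L in \<open>fastforce simp: L_def\<close>)
  qed
  obtain c d t where e1: "(c, d, t) \<in> E" "c \<le> 0" "0 < d" "bow (c, d, t) ` {0<..<1} \<inter> closure R \<noteq> {}"
    by (rule touched[of 0]) (use gap in auto)
  obtain c' d' t' where e2: "(c', d', t') \<in> E" "c' \<le> n - 2" "n - 2 < d'"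
      "bow (c', d', t') ` {0<..<1} \<inter> closure R \<noteq> {}"
    by (rule touched[of "n - 2"]) (use gap in auto)
  obtain c'' d'' t'' where e3: "(c'', d'', t'') \<in> E" "c'' \<le> g" "g < d''"
      "bow (c'', d'', t'') ` {0<..<1} \<inter> closure R \<noteq> {}"
    by (rule touched[of g]) (use gap in auto)
  have g: "c'' = g" "d'' = Suc g" using gap(3)[OF e3(1-3)] axis_only[of c'' d''] e3(1-3) by auto
  \<comment> \<open>An edge spanning the first and the last segment would also span the one at
    \<open>g\<close>, so by \<open>gap\<close> it would be a unit segment.\<close>
  have "(c, d, t) \<noteq> (c', d', t')"
  proof
    assume eq: "(c, d, t) = (c', d', t')"
    then have "t = 0" using gap(3)[OF e1(1)] gap(2) e1 e2 by auto
    then show False using axis_only[of c d] e1 e2 eq gap by auto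
  qed
  moreover have "(c, d, t) \<noteq> (c'', d'', t'')" "(c', d', t') \<noteq> (c'', d'', t'')"
    using g gap(1,2) e1 e2 by auto
  ultimately have card: "card {(c, d, t), (c', d', t'), (c'', d'', t'')} = 3"
    by (intro card_edges_3)
  moreover have "connected R"
    unfolding R_def by (intro connected_band cL continuous_intros) auto
  ultimately have "rich R"
    unfolding rich_def using RD e1 e2 e3
    by (intro conjI exI[of _ "{(c, d, t), (c', d', t'), (c'', d'', t'')}"]) auto
  then show ?thesis using zR by blast
qed

lemma rich_cover:
  assumes z: "z \<notin> drawing"
  shows "\<exists>R. z \<in> R \<and> rich R"
proof -
  \<comment> \<open>A point of the axis is given to the upper side; off the drawing it lies beyond
    the outermost vertices, where no arc passes.\<close>
  define s :: int where "s = (if Im z < 0 then -1 else 1)"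
  have s: "s = 1 \<or> s = -1" "0 \<le> of_int s * Im z" by (auto simp: s_def)
  define P where "P = (\<lambda>(c, d). (c, d, s) \<in> E \<and> c < Re z \<and> Re z < d \<and> of_int s * Im z < hgt (c, d) (Re z))"
  show ?thesis
  proof (cases "\<exists>e. P e")
    case False
    show ?thesis
    proof (rule outer_region[OF s(1) z s(2)])
      fix c d assume "(c, d, s) \<in> E" "c < Re z" "Re z < d"
      moreover have "\<not> P (c, d)" using False by blast
      ultimately show "hgt (c, d) (Re z) \<le> of_int s * Im z" by (auto simp: P_def)
    qed
  next
    case True
    \<comment> \<open>Among the arcs above the point a shortest one is chosen: an arc properly
      nested in it is shorter and so cannot be above the point.\<close>
    define e where "e = arg_min (\<lambda>(c, d). d - c) P"
    obtain a b where e: "e = (a, b)" by fastforce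
    have Pe: "P e" using True unfolding e_def by (metis arg_min_natI)
    have least: "b - a \<le> d - c" if "P (c, d)" for c d
      using arg_min_nat_le[of P "(c, d)" "\<lambda>(c, d). d - c"] that e by (simp add: e_def[symmetric])
    have ab: "(a, b, s) \<in> E" "a < Re z" "Re z < b" "of_int s * Im z < hgt (a, b) (Re z)"
      using Pe e by (auto simp: P_def)
    have "Im z \<noteq> 0"
    proof
      assume 0: "Im z = 0"
      have "0 \<le> Re z" "Re z \<le> real n - 1" using ab E_bounds[OF ab(1)] by auto
      then obtain j where j: "Suc j < n" "j \<le> Re z" "Re z \<le> Suc j" using between_consecutive by blast
      then have "z \<in> drawing" unfolding drawing_iff using axis[OF j(1)] 0 by fastforce
      then show False using z by blast
    qed
    then have pos: "0 < of_int s * Im z" by (auto simp: s_def)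
    show ?thesis
    proof (rule inner_region[OF s(1) ab(1) z pos ab(2-4)])
      fix c d assume cd: "(c, d, s) \<in> E" "a \<le> c" "d \<le> b" "(c, d) \<noteq> (a, b)" "c < Re z" "Re z < d"
      show "hgt (c, d) (Re z) \<le> of_int s * Im z"
      proof (rule ccontr)
        assume "\<not> ?thesis"
        then have "P (c, d)" using cd by (auto simp: P_def)
        then have "b - a \<le> d - c" by (rule least)
        then show False using cd E_bounds[OF cd(1)] by auto
      qed
    qed
  qed
qed

lemma face_degree_graph:
  assumes f: "f \<in> faces graph position curve"
  shows "3 \<le> face_degree graph position curve f"
proof -
  have "f \<in> components (- drawing)" using f by (simp add: faces_def drawing_def)
  then obtain z where z: "z \<in> f" "z \<notin> drawing"
    using in_components_nonempty in_components_subset by blast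
  then obtain R where R: "z \<in> R" "rich R" using rich_cover by blast
  then obtain X where X: "X \<subseteq> E" "card X = 3" "\<forall>e\<in>X. bow e ` {0<..<1} \<inter> closure R \<noteq> {}"
    unfolding rich_def by blast
  show ?thesis
  proof (rule face_degree_ge_3[OF _ f, where R = R and X = "to_nat ` X"])
    show "R \<inter> (position ` verts graph \<union> (\<Union>e\<in>edges graph. path_image (curve e))) = {}"
      using R by (simp add: rich_def drawing_def)
    show "card (to_nat ` X) = 3" using X by (simp add: card_image)
  qed (use R X z finite_E in \<open>auto simp: rich_def open_edge_def\<close>)
qed

end

section \<open>Induced forests\<close>

text \<open>Both edges of a cycle at its largest vertex \<open>Suc j\<close> join it to \<open>j\<close>.\<close>

lemma forest_consecutive:
  assumes "\<And>e. e \<in> edges H \<Longrightarrow> \<exists>j::nat. ends H e = {j, Suc j}" and "inj_on (ends H) (edges H)"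
  shows "forest H"
  unfolding forest_def
proof (intro notI, elim exE)
  fix vs es assume cyc: "is_cycle H vs es"
  define l where "l = length vs"
  have l: "2 \<le> l" "length es = l" "distinct es" "set es \<subseteq> edges H"
    and ends: "\<And>i. i < l \<Longrightarrow> ends H (es ! i) = {vs ! i, vs ! (Suc i mod l)}"
    using cyc by (auto simp: is_cycle_def l_def)
  define x where "x = Max (set vs)"
  have le: "v \<le> x" if "v \<in> set vs" for v using that by (simp add: x_def)
  have "x \<in> set vs" unfolding x_def using l by (intro Max_in) (auto simp: l_def)
  then obtain i where i: "i < l" "vs ! i = x" by (auto simp: in_set_conv_nth l_def)
  \<comment> \<open>The cyclic predecessor, so that \<open>es ! i'\<close> is the other edge of the
    cycle at \<open>x\<close>.\<close>
  define i' where "i' = (if i = 0 then l - 1 else i - 1)"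
  have i': "i' < l" "Suc i' mod l = i" "i' \<noteq> i" using i l by (auto simp: i'_def)
  have top: "ends H (es ! q) = {x - 1, x}" if "q < l" "x \<in> ends H (es ! q)" for q
  proof -
    have "es ! q \<in> edges H" using that l by (auto simp: subset_iff)
    then obtain j where j: "ends H (es ! q) = {j, Suc j}" using assms(1) by blast
    have "Suc q mod l < l" using l by simp
    then have "ends H (es ! q) \<subseteq> set vs" using ends[OF that(1)] that by (simp add: l_def)
    then have "Suc j \<le> x" using le j by auto
    then have "x = Suc j" using that j by auto
    then show ?thesis using j by simp
  qed
  have "ends H (es ! i) = ends H (es ! i')"
    using top[OF i(1)] top[OF i'(1)] ends[OF i(1)] ends[OF i'(1)] i i' by simp
  moreover have "es ! i \<in> edges H" "es ! i' \<in> edges H" using i i' l by (auto simp: subset_iff)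
  ultimately have "es ! i = es ! i'" using assms(2) by (auto dest: inj_onD)
  then show False using i i' l by (simp add: nth_eq_iff_index_eq)
qed

lemma forest_no_2_cycle:
  assumes "forest (induced M S)" "x \<in> S" "y \<in> S" "x \<noteq> y"
    "e \<in> edges M" "e' \<in> edges M" "e \<noteq> e'" "ends M e = {x, y}" "ends M e' = {x, y}"
  shows False
proof -
  have "is_cycle (induced M S) [x, y] [e, e']"
    using assms by (auto simp: is_cycle_def induced_def less_Suc_eq numeral_2_eq_2)
  then show False using assms(1) by (auto simp: forest_def)
qed

lemma forest_no_3_cycle:
  assumes "forest (induced M S)" "{x, y, z} \<subseteq> S" "x \<noteq> y" "y \<noteq> z" "x \<noteq> z"
    "{e, e', e''} \<subseteq> edges M" "ends M e = {x, y}" "ends M e' = {y, z}" "ends M e'' = {z, x}"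
  shows False
proof -
  have "e \<noteq> e'" "e' \<noteq> e''" "e \<noteq> e''" using assms by (auto simp: doubleton_eq_iff)
  then have "is_cycle (induced M S) [x, y, z] [e, e', e'']"
    using assms by (auto simp: is_cycle_def induced_def less_Suc_eq numeral_2_eq_2)
  then show False using assms(1) by (auto simp: forest_def)
qed

lemma forest_inter_double_clique:
  assumes "forest (induced M S)" "finite K"
    and "\<And>x y. x \<in> K \<Longrightarrow> y \<in> K \<Longrightarrow> x \<noteq> y \<Longrightarrow>
      \<exists>e\<in>edges M. \<exists>e'\<in>edges M. e \<noteq> e' \<and> ends M e = {x, y} \<and> ends M e' = {x, y}"
  shows "card (S \<inter> K) \<le> 1"
proof (rule ccontr)
  assume "\<not> card (S \<inter> K) \<le> 1"
  then obtain x y where xy: "x \<in> S \<inter> K" "y \<in> S \<inter> K" "x \<noteq> y"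
    using assms(2) by (metis One_nat_def card_le_Suc0_iff_eq finite_Int)
  then obtain e e' where "e \<in> edges M" "e' \<in> edges M" "e \<noteq> e'" "ends M e = {x, y}" "ends M e' = {x, y}"
    using assms(3)[of x y] by blast
  then show False using forest_no_2_cycle[OF assms(1), of x y e e'] xy by blast
qed

lemma forest_inter_clique:
  assumes "forest (induced M S)"
    and "\<And>x y. x \<in> K \<Longrightarrow> y \<in> K \<Longrightarrow> x \<noteq> y \<Longrightarrow> \<exists>e\<in>edges M. ends M e = {x, y}"
  shows "card (S \<inter> K) \<le> 2"
proof (rule ccontr)
  assume "\<not> card (S \<inter> K) \<le> 2"
  then have "3 \<le> card (S \<inter> K)" by simp
  then obtain T where "T \<subseteq> S \<inter> K" "card T = 3" by (rule obtain_subset_with_card_n)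
  then obtain x y z where xyz: "{x, y, z} \<subseteq> S \<inter> K" "x \<noteq> y" "y \<noteq> z" "x \<noteq> z"
    unfolding card_3_iff by blast
  obtain e where e: "e \<in> edges M" "ends M e = {x, y}" using assms(2)[of x y] xyz by blast
  obtain e' where e': "e' \<in> edges M" "ends M e' = {y, z}" using assms(2)[of y z] xyz by blast
  obtain e'' where e'': "e'' \<in> edges M" "ends M e'' = {z, x}" using assms(2)[of z x] xyz by blast
  show False using forest_no_3_cycle[OF assms(1), of x y z e e' e''] xyz e e' e'' by simp
qed

section \<open>The sequence\<close>

text \<open>The doubled triangles have the vertices \<open>v k i\<close>, \<open>u k i\<close>, \<open>w k i\<close> for \<open>i < k\<close>, the copies of \<open>K\<^sub>4\<close>
  the vertices \<open>s, \<dots>, s + 3\<close> for \<open>s \<in> quads k\<close>; the remaining path edges make the drawing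
  connected and do not affect the size of a largest induced forest.\<close>

abbreviation "v k i \<equiv> k - Suc i"
abbreviation "u k i \<equiv> k + 4 + 6 * i"
abbreviation "w k i \<equiv> k + 9 + 6 * i"

text \<open>The axis carries, from left to right, the corners \<open>v k i\<close> with
  \<open>i\<close> decreasing, a K4, then for each \<open>i\<close> a block of six vertices
  \<open>u k i\<close>, K4, \<open>w k i\<close>, and a last K4. The reversed order on the left
  produces the nesting: triangle \<open>i\<close> lies between \<open>v k (i + 1)\<close> and
  \<open>u k (i + 1)\<close>. If \<open>k > 0\<close>, the first K4 lies inside the double edge from
  \<open>v k 0\<close> to \<open>u k 0\<close> and the last one outside all triangles.\<close>

definition quads :: "nat \<Rightarrow> nat set" where
  "quads k = {k, 7 * k + 4} \<union> (\<lambda>i. k + 5 + 6 * i) ` {..<k}"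

definition path_edges :: "nat \<Rightarrow> (nat \<times> nat \<times> int) set" where
  "path_edges k = {(j, Suc j, 0) | j. Suc j < 7 * k + 8}"

text \<open>The other three edges of each K4 are path edges.\<close>

definition quad_edges :: "nat \<Rightarrow> (nat \<times> nat \<times> int) set" where
  "quad_edges k = (\<Union>s\<in>quads k. {(s, s + 3, 1), (s, s + 2, 1), (s + 1, s + 3, -1)})"

definition triangle_edges :: "nat \<Rightarrow> (nat \<times> nat \<times> int) set" where
  "triangle_edges k = (\<Union>i<k. \<Union>s\<in>{1, -1}.
     {(v k i, u k i, s), (v k i, w k i, s), (u k i, w k i, s)})"

definition book_edges :: "nat \<Rightarrow> (nat \<times> nat \<times> int) set" where
  "book_edges k = path_edges k \<union> quad_edges k \<union> triangle_edges k"

section \<open>The layout is a book\<close>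

lemma quads_less: "s \<in> quads k \<Longrightarrow> k \<le> s \<and> s + 3 < 7 * k + 8"
  by (auto simp: quads_def)

lemma quads_far: "s \<in> quads k \<Longrightarrow> s' \<in> quads k \<Longrightarrow> s = s' \<or> s + 4 \<le> s' \<or> s' + 4 \<le> s"
  by (auto simp: quads_def)

text \<open>No corner \<open>u k i\<close> or \<open>w k i\<close> falls among the four consecutive
  positions of a K4. So K4 arcs do not cross triangle arcs, and these corners are never inner
  vertices of a K4.\<close>

lemma quad_triangle:
  assumes "s \<in> quads k" "i < k"
  shows "(s + 3 < u k i \<or> u k i < s) \<and> (s + 3 < w k i \<or> w k i < s)"
proof -
  consider "s = k" | "s = 7 * k + 4" | j where "s = k + 5 + 6 * j"
    using assms(1) by (auto simp: quads_def)
  then show ?thesis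
  proof cases
    case (3 j)
    then show ?thesis by (cases i j rule: linorder_cases) auto
  qed (use assms(2) in auto)
qed

text \<open>The parabolas without their sides, for the facts in which the side does not
  matter.\<close>

definition arcs :: "nat \<Rightarrow> (nat \<times> nat) set" where
  "arcs k = (\<Union>s\<in>quads k. {(s, s + 3), (s, s + 2), (s + 1, s + 3)}) \<union>
     (\<Union>i<k. {(v k i, u k i), (v k i, w k i), (u k i, w k i)})"

lemma book_edges_arcs: "(a, b, s) \<in> book_edges k \<Longrightarrow> s \<noteq> 0 \<Longrightarrow> (a, b) \<in> arcs k"
  by (auto simp: book_edges_def path_edges_def quad_edges_def triangle_edges_def arcs_def)

lemma arcs_bounds: "(a, b) \<in> arcs k \<Longrightarrow> Suc a < b \<and> b < 7 * k + 8"
  by (auto simp: arcs_def dest: quads_less)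

text \<open>The arcs \<open>(s, s + 2)\<close> and \<open>(s + 1, s + 3)\<close> of a \<open>K\<^sub>4\<close> cross, hence lie on different sides.\<close>

lemma book_edges_noncrossing:
  assumes "(a, b, t) \<in> book_edges k" "(c, d, t) \<in> book_edges k" "t \<noteq> 0"
  shows "b \<le> c \<or> d \<le> a \<or> a \<le> c \<and> d \<le> b \<or> c \<le> a \<and> b \<le> d"
proof -
  define Q where "Q s = (if t = 1 then {(s, s + 3), (s, s + 2)} else {(s + 1, s + 3)})" for s :: nat
  \<comment> \<open>The left corner is a variable \<open>p\<close>, later tied by
    \<open>p + Suc i = k\<close>, which keeps truncated subtraction out of the case
    analysis.\<close>
  define T where "T i p = {(p, u k i), (p, w k i), (u k i, w k i)}" for i p
  have cases: "(\<exists>s\<in>quads k. (x, y) \<in> Q s) \<or> (\<exists>i<k. \<exists>p. p + Suc i = k \<and> (x, y) \<in> T i p)"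
    if "(x, y, t) \<in> book_edges k" for x y
  proof -
    from that assms(3) consider "(x, y, t) \<in> quad_edges k" | "(x, y, t) \<in> triangle_edges k"
      unfolding book_edges_def path_edges_def by blast
    then show ?thesis
    proof cases
      case 1
      then obtain s where "s \<in> quads k" "(x, y, t) \<in> {(s, s + 3, 1), (s, s + 2, 1), (s + 1, s + 3, -1)}"
        unfolding quad_edges_def by blast
      moreover from this(2) have "(x, y) \<in> Q s" by (auto simp: Q_def)
      ultimately show ?thesis by blast
    next
      case 2
      then obtain i where i: "i < k" "(x, y) \<in> T i (v k i)"
        unfolding triangle_edges_def T_def by blast
      moreover have "v k i + Suc i = k" using i by simp
      ultimately show ?thesis by blast
    qed
  qed
  have Q: "s \<le> x \<and> y \<le> s + 3" if "(x, y) \<in> Q s" for x y s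
    using that by (auto simp: Q_def split: if_splits)
  \<comment> \<open>The K4 lies to the right of \<open>p\<close> and on one side of each other
    corner, so its whole interval is inside or outside the triangle arc.\<close>
  have mixed: "y \<le> x' \<or> y' \<le> x \<or> x \<le> x' \<and> y' \<le> y"
    if "s \<in> quads k" "(x', y') \<in> Q s" "i < k" "p + Suc i = k" and T: "(x, y) \<in> T i p" for s i p x y x' y'
  proof -
    have *: "s \<le> x'" "y' \<le> s + 3" "p \<le> s" "s + 3 < u k i \<or> u k i < s" "s + 3 < w k i \<or> w k i < s"
      using Q[OF that(2)] quads_less[OF that(1)] quad_triangle[OF that(1,3)] that(4) by simp_all
    have "x = p \<and> y = u k i \<or> x = p \<and> y = w k i \<or> x = u k i \<and> y = w k i"
      using T unfolding T_def by blast
    then show ?thesis using * by (elim disjE conjE; simp)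
  qed
  have T: "p \<le> x \<and> y \<le> w k i \<and> (x = p \<and> u k i \<le> y \<or> x = u k i)"
    if "p + Suc i = k" "(x, y) \<in> T i p" for i p x y
    using that by (auto simp: T_def)
  \<comment> \<open>The inner triangle lies strictly between \<open>q\<close> and
    \<open>u k j\<close>: arcs of the outer triangle starting at \<open>q\<close> enclose it, and
    the arc starting at \<open>u k j\<close> is to its right.\<close>
  have nested: "y \<le> x' \<or> y' \<le> x \<or> x' \<le> x \<and> y \<le> y'"
    if "p + Suc i = k" "(x, y) \<in> T i p" "q + Suc j = k" "(x', y') \<in> T j q" "i < j" for i j p q x y x' y'
  proof -
    have "q < p" "w k i < u k j" using that(1,3,5) by auto
    then show ?thesis using T[OF that(1,2)] T[OF that(3,4)] by linarith
  qed
  from cases[OF assms(1)] cases[OF assms(2)] show ?thesis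
  proof (elim disjE bexE exE conjE)
    fix s s' assume s: "s \<in> quads k" "s' \<in> quads k" "(a, b) \<in> Q s" "(c, d) \<in> Q s'"
    show ?thesis
    proof (cases "s = s'")
      case True
      then show ?thesis using s(3,4) by (auto simp: Q_def split: if_splits)
    next
      case False
      then show ?thesis using quads_far[OF s(1,2)] Q[OF s(3)] Q[OF s(4)] by linarith
    qed
  next
    fix s i p assume "s \<in> quads k" "(a, b) \<in> Q s" "i < k" "p + Suc i = k" "(c, d) \<in> T i p"
    then show ?thesis using mixed[of s a b i p c d] by blast
  next
    fix s i p assume "s \<in> quads k" "(c, d) \<in> Q s" "i < k" "p + Suc i = k" "(a, b) \<in> T i p"
    then show ?thesis using mixed[of s c d i p a b] by blast
  next
    fix i j p q assume ij: "p + Suc i = k" "(a, b) \<in> T i p" "q + Suc j = k" "(c, d) \<in> T j q"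
    consider "i < j" | "j < i" | "i = j" "p = q" using ij(1,3) by linarith
    then show ?thesis
    proof cases
      case 1
      then show ?thesis using nested[OF ij] by blast
    next
      case 2
      then show ?thesis using nested[OF ij(3,4) ij(1,2)] by blast
    next
      case 3
      have "(c, d) \<in> T i p" unfolding 3 by (rule ij(4))
      then show ?thesis using ij(2) unfolding T_def by auto
    qed
  qed
qed

text \<open>The gap is the segment in front of the last K4. Its left end \<open>7 * k + 3\<close> is
  the corner \<open>w k (k - 1)\<close> or, for \<open>k = 0\<close>, the last vertex of the first
  K4.\<close>

lemma book_book_edges: "book (7 * k + 8) (book_edges k) (7 * k + 3)"
proof
  show "a < b \<and> b < 7 * k + 8 \<and> s \<in> {-1, 0, 1}" if "(a, b, s) \<in> book_edges k" for a b s
    using that by (auto simp: book_edges_def path_edges_def quad_edges_def triangle_edges_def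
        dest: quads_less)
  show "(j, Suc j, 0) \<in> book_edges k" if "Suc j < 7 * k + 8" for j
    using that by (auto simp: book_edges_def path_edges_def)
  show "b = Suc a" if "(a, b, 0) \<in> book_edges k" for a b
    using that by (auto simp: book_edges_def path_edges_def quad_edges_def triangle_edges_def)
  show "Suc a < b" if "(a, b, s) \<in> book_edges k" "s \<noteq> 0" for a b s
    using book_edges_arcs[OF that] arcs_bounds by blast
  show "s = 0" if "(a, b, s) \<in> book_edges k" "a \<le> 7 * k + 3" "7 * k + 3 < b" for a b s
    using book_edges_arcs[OF that(1)] that(2,3) by (auto simp: arcs_def quads_def)
qed (use book_edges_noncrossing in auto)

interpretation book "7 * k + 8" "book_edges k" "7 * k + 3" for k
  by (rule book_book_edges)

abbreviation seq_graph :: "nat \<Rightarrow> (nat, nat) mgraph" where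
  "seq_graph k \<equiv> book.graph (7 * k + 8) (book_edges k)"

section \<open>The size of a largest induced forest\<close>

lemma card_forest_le:
  assumes F: "forest (induced (seq_graph k) S)" and S: "S \<subseteq> {..<7 * k + 8}"
  shows "card S \<le> 3 * k + 4"
proof -
  define T where "T = (\<lambda>i. {v k i, u k i, w k i})"
  define Q where "Q = (\<lambda>s. {s..s + 3 :: nat})"
  have T1: "card (S \<inter> T i) \<le> 1" if i: "i < k" for i
  proof (rule forest_inter_double_clique[OF F])
    fix x y assume "x \<in> T i" "y \<in> T i" "x \<noteq> y"
    then obtain a b where ab: "{x, y} = {a, b}"
        "(a, b) \<in> {(v k i, u k i), (v k i, w k i), (u k i, w k i)}"
      unfolding T_def by blast
    then have "(a, b, 1) \<in> book_edges k" "(a, b, -1) \<in> book_edges k"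
      using i by (auto simp: book_edges_def triangle_edges_def)
    then show "\<exists>e\<in>edges (seq_graph k). \<exists>e'\<in>edges (seq_graph k). e \<noteq> e' \<and>
        ends (seq_graph k) e = {x, y} \<and> ends (seq_graph k) e' = {x, y}"
      unfolding ab(1)
      by (intro bexI[of _ "to_nat (a, b, 1 :: int)"] bexI[of _ "to_nat (a, b, -1 :: int)"]) auto
  qed (simp add: T_def)
  have Q2: "card (S \<inter> Q s) \<le> 2" if s: "s \<in> quads k" for s
  proof (rule forest_inter_clique[OF F])
    fix x y assume xy: "x \<in> Q s" "y \<in> Q s" "x \<noteq> y"
    define a b where "a = min x y" and "b = max x y"
    have ab: "{x, y} = {a, b}" "s \<le> a" "a < b" "b \<le> s + 3"
      using xy by (auto simp: a_def b_def Q_def min_def max_def)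
    \<comment> \<open>Of the six pairs, the three at distance 1 are joined by the path, the others
      by parabolas.\<close>
    then have "a = s \<and> b = s + 3 \<or> a = s \<and> b = s + 2 \<or> a = s + 1 \<and> b = s + 3 \<or> b = Suc a" by linarith
    then obtain t where "(a, b, t) \<in> book_edges k"
      using s ab quads_less[OF s] by (auto simp: book_edges_def path_edges_def quad_edges_def)
    then show "\<exists>e\<in>edges (seq_graph k). ends (seq_graph k) e = {x, y}"
      unfolding ab(1) by (intro bexI[of _ "to_nat (a, b, t)"]) auto
  qed
  \<comment> \<open>Since the triangles and the K4 cover all vertices, the local bounds 1 and 2 add
    up to a bound for \<open>S\<close>.\<close>
  have cover: "{..<7 * k + 8} \<subseteq> (\<Union>i<k. T i) \<union> (\<Union>s\<in>quads k. Q s)"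
  proof
    fix x assume "x \<in> {..<7 * k + 8}"
    then consider "x < k" | "k \<le> x" "x < k + 4" | "k + 4 \<le> x" "x < 7 * k + 4" | "7 * k + 4 \<le> x" "x < 7 * k + 8"
      by force
    then show "x \<in> (\<Union>i<k. T i) \<union> (\<Union>s\<in>quads k. Q s)"
    proof cases
      case 1
      then have "x \<in> T (k - Suc x)" "k - Suc x < k" by (auto simp: T_def)
      then show ?thesis by blast
    next
      case 2
      then have "x \<in> Q k" by (auto simp: Q_def)
      then show ?thesis by (auto simp: quads_def)
    next
      case 3
      \<comment> \<open>The index of the block of six containing \<open>x\<close>: its first and
        last vertices are corners of triangle \<open>i\<close>, the middle four form a K4.\<close>
      define i where "i = (x - (k + 4)) div 6"
      have i: "i < k" "k + 4 + 6 * i \<le> x" "x < k + 4 + 6 * i + 6"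
        using 3 unfolding i_def by auto
      then have "x \<in> T i \<or> x \<in> Q (k + 5 + 6 * i)" unfolding T_def Q_def by auto
      then show ?thesis using i(1) by (auto simp: quads_def)
    next
      case 4
      then have "x \<in> Q (7 * k + 4)" by (auto simp: Q_def)
      then show ?thesis by (auto simp: quads_def)
    qed
  qed
  have fq: "finite (quads k)" by (simp add: quads_def)
  have cq: "card (quads k) \<le> k + 2"
  proof -
    have "card (quads k) \<le> card {k, 7 * k + 4} + card ((\<lambda>i. k + 5 + 6 * i) ` {..<k})"
      unfolding quads_def by (rule card_Un_le)
    also have "\<dots> \<le> 2 + k"
      by (intro add_mono order.trans[OF card_image_le]) (auto simp: card_insert_if)
    finally show ?thesis by simp
  qed
  have "S \<subseteq> (\<Union>i<k. T i) \<union> (\<Union>s\<in>quads k. Q s)" using cover S by (rule subset_trans[rotated])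
  then have "S = (\<Union>i<k. S \<inter> T i) \<union> (\<Union>s\<in>quads k. S \<inter> Q s)" by blast
  then have "card S = card ((\<Union>i<k. S \<inter> T i) \<union> (\<Union>s\<in>quads k. S \<inter> Q s))" by (rule arg_cong)
  also have "\<dots> \<le> card (\<Union>i<k. S \<inter> T i) + card (\<Union>s\<in>quads k. S \<inter> Q s)"
    by (rule card_Un_le)
  also have "\<dots> \<le> (\<Sum>i<k. card (S \<inter> T i)) + (\<Sum>s\<in>quads k. card (S \<inter> Q s))"
    by (intro add_mono card_UN_le fq) auto
  also have "\<dots> \<le> (\<Sum>i<k. 1) + (\<Sum>s\<in>quads k. 2)"
    by (intro add_mono sum_mono) (use T1 Q2 in auto)
  also have "\<dots> \<le> k + 2 * (k + 2)" using cq by simp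
  finally show ?thesis by simp
qed

text \<open>The forest takes the corner \<open>v k i\<close> of each triangle and the two inner
  vertices of each K4. Every parabola has an end outside this set: an outer vertex of a K4, or its
  right end at some \<open>u k i\<close> or \<open>w k i\<close>. Only path segments
  survive.\<close>

lemma large_forest:
  obtains S where "S \<subseteq> {..<7 * k + 8}" "forest (induced (seq_graph k) S)" "card S = 3 * k + 4"
proof
  define Q where "Q = (\<lambda>s. {s + 1, s + 2 :: nat})"
  define S where "S = {..<k} \<union> (\<Union>s\<in>quads k. Q s)"
  show "S \<subseteq> {..<7 * k + 8}" by (auto simp: S_def Q_def dest: quads_less)
  have axis: "t = 0" if e: "(a, b, t) \<in> book_edges k" and ab: "a \<in> S" "b \<in> S" for a b t
  proof (rule ccontr)
    assume "t \<noteq> 0"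
    have S: "x < k \<or> (\<exists>s\<in>quads k. x = s + 1 \<or> x = s + 2)" if "x \<in> S" for x
      using that by (auto simp: S_def Q_def)
    have top: "u k i \<notin> S \<and> w k i \<notin> S" if "i < k" for i
    proof (intro conjI notI)
      assume "u k i \<in> S"
      then obtain s where s: "s \<in> quads k" "u k i = s + 1 \<or> u k i = s + 2" using S[of "u k i"] by auto
      then show False using quad_triangle[OF s(1) that] by linarith
    next
      assume "w k i \<in> S"
      then obtain s where s: "s \<in> quads k" "w k i = s + 1 \<or> w k i = s + 2" using S[of "w k i"] by auto
      then show False using quad_triangle[OF s(1) that] by linarith
    qed
    have quad: "s \<notin> S \<and> s + 3 \<notin> S" if s: "s \<in> quads k" for s
    proof -
      have "x \<notin> S" if x: "x = s \<or> x = s + 3" for x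
      proof
        assume "x \<in> S"
        moreover have "\<not> x < k" using x quads_less[OF s] by auto
        ultimately obtain s' where s': "s' \<in> quads k" "x = s' + 1 \<or> x = s' + 2" using S by blast
        then show False using quads_far[OF s s'(1)] x by linarith
      qed
      then show ?thesis by blast
    qed
    have "(\<exists>s\<in>quads k. a = s \<or> b = s + 3) \<or> (\<exists>i<k. b = u k i \<or> b = w k i)"
      using book_edges_arcs[OF e \<open>t \<noteq> 0\<close>] unfolding arcs_def by blast
    then show False using ab top quad by blast
  qed
  show "forest (induced (seq_graph k) S)"
  proof (rule forest_consecutive)
    have *: "\<exists>j. e = to_nat (j, Suc j, 0 :: int)" if eS: "e \<in> edges (induced (seq_graph k) S)" for e
    proof -
      obtain x where x: "e = to_nat x" "x \<in> book_edges k"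
        using eS by (auto simp: induced_def)
      obtain a b t where "x = (a, b, t)" by (cases x)
      then have e: "e = to_nat (a, b, t)" "(a, b, t) \<in> book_edges k" using x by auto
      then have "a \<in> S" "b \<in> S" using eS by (auto simp: induced_def)
      then have "t = 0" using axis e(2) by blast
      then show ?thesis using e axis_only by blast
    qed
    then show "\<exists>j. ends (induced (seq_graph k) S) e = {j, Suc j}"
      if "e \<in> edges (induced (seq_graph k) S)" for e
      using that by (force simp: induced_def)
    show "inj_on (ends (induced (seq_graph k) S)) (edges (induced (seq_graph k) S))"
    proof (rule inj_onI)
      fix e e' assume "e \<in> edges (induced (seq_graph k) S)" "e' \<in> edges (induced (seq_graph k) S)"
      then obtain j j' where j: "e = to_nat (j, Suc j, 0 :: int)" "e' = to_nat (j', Suc j', 0 :: int)"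
        using * by blast
      assume "ends (induced (seq_graph k) S) e = ends (induced (seq_graph k) S) e'"
      then have "{j, Suc j} = {j', Suc j'}" by (simp add: j induced_def)
      then show "e = e'" using j by (auto simp: doubleton_eq_iff)
    qed
  qed
  have "card (quads k) = k + 2"
  proof -
    have "inj_on (\<lambda>i. k + 5 + 6 * i) {..<k}" by (auto simp: inj_on_def)
    moreover have "{k, 7 * k + 4} \<inter> (\<lambda>i. k + 5 + 6 * i) ` {..<k} = {}" by auto
    ultimately show ?thesis
      unfolding quads_def by (subst card_Un_disjoint) (auto simp: card_image)
  qed
  moreover have "card (\<Union>s\<in>quads k. Q s) = (\<Sum>s\<in>quads k. card (Q s))"
  proof (rule card_UN_disjoint)
    show "\<forall>s\<in>quads k. \<forall>s'\<in>quads k. s \<noteq> s' \<longrightarrow> Q s \<inter> Q s' = {}"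
      by (auto simp: Q_def dest: quads_far)
  qed (auto simp: Q_def quads_def)
  ultimately have "card (\<Union>s\<in>quads k. Q s) = 2 * (k + 2)" by (simp add: Q_def)
  moreover have "{..<k} \<inter> (\<Union>s\<in>quads k. Q s) = {}" by (auto simp: Q_def dest: quads_less)
  ultimately show "card S = 3 * k + 4"
    unfolding S_def by (subst card_Un_disjoint) (auto simp: Q_def quads_def)
qed

lemma max_induced_forest_seq_graph: "max_induced_forest (seq_graph k) = 3 * k + 4"
  unfolding max_induced_forest_def
proof (rule Max_eqI)
  let ?A = "{card S |S. S \<subseteq> verts (seq_graph k) \<and> forest (induced (seq_graph k) S)}"
  show le: "x \<le> 3 * k + 4" if "x \<in> ?A" for x using that card_forest_le by auto
  then show "finite ?A" using finite_subset[of ?A "{..3 * k + 4}"] by blast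
  obtain S where "S \<subseteq> {..<7 * k + 8}" "forest (induced (seq_graph k) S)" "card S = 3 * k + 4"
    by (rule large_forest)
  then show "3 * k + 4 \<in> ?A" unfolding graph_simps(1) by (intro CollectI exI[of _ S]) simp
qed

theorem theorem20:
  shows "\<exists>M :: nat \<Rightarrow> (nat, nat) mgraph.
    (\<forall>k. multigraph (M k) \<and> planar (M k) \<and>
       (\<exists>p \<gamma>. plane_embedding (M k) p \<gamma> \<and>
          (\<forall>f\<in>faces (M k) p \<gamma>. face_degree (M k) p \<gamma> f \<noteq> 2)) \<and>
       real (max_induced_forest (M k)) = 3 / 7 * real (card (verts (M k))) + 4 / 7) \<and>
    (\<forall>N. \<exists>k. N < card (verts (M k)))"
proof (intro exI[of _ seq_graph] conjI allI)
  fix k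
  show "multigraph (seq_graph k)" by (rule multigraph_graph)
  show "planar (seq_graph k)" unfolding planar_def using plane_embedding_graph by blast
  show "\<exists>p \<gamma>. plane_embedding (seq_graph k) p \<gamma> \<and>
      (\<forall>f\<in>faces (seq_graph k) p \<gamma>. face_degree (seq_graph k) p \<gamma> f \<noteq> 2)"
  proof (intro exI conjI ballI)
    show "plane_embedding (seq_graph k) position (curve :: nat \<Rightarrow> _)" by (rule plane_embedding_graph)
    show "face_degree (seq_graph k) position curve f \<noteq> 2"
      if "f \<in> faces (seq_graph k) position curve" for f
      using face_degree_graph[OF that] by simp
  qed
  show "real (max_induced_forest (seq_graph k)) = 3 / 7 * real (card (verts (seq_graph k))) + 4 / 7"
    unfolding max_induced_forest_seq_graph graph_simps(1) card_lessThan by (simp add: field_simps)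
next
  fix N
  show "\<exists>k. N < card (verts (seq_graph k))" by (intro exI[of _ N]) simp
qed

end
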